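(* Let $N\ge 2$, $R\in(0,\infty)$, $\delta\in[0,R)$ and $\alpha>R$. Let $f:[\delta,R]\times[0,\alpha)\to[0,\infty)$ be continuous with $f(r,s)>0$ for all $(r,s)\in[\delta,R]\times(0,\alpha)$. Suppose that $\lim_{s\to0^+}\frac{f(r,s)}{s}=\infty$ uniformly in $r\in[\delta,R]$, and $f(r,0)=0$ for $r\in[\delta,R]$. Then the problem $$(r^{N-1}\phi_1(u'))'+\lambda r^{N-1}f(r,u)=0\ \text{ on }(\delta,R),\qquad u'(\delta)=u(R)=0,$$ has at least one positive solution for any $\lambda>0$.
   Context: $\phi_1(s)=\frac{s}{\sqrt{1-s^2}}$ for $|s|<1$. A positive solution is a function $u\in C^1[\delta,R]$ with values in $[0,\alpha)$ (where $f$ is defined), with $u>0$ on $[\delta,R)$, $|u'|<1$ on $[\delta,R]$ and $r^{N-1}\phi_1(u')$ continuously differentiable, satisfying the differential equation and the boundary conditions. *)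

theory Defs
  imports "HOL-Analysis.Analysis"
begin

definition phi1 :: "real \<Rightarrow> real" where
  "phi1 s = s / sqrt (1 - s\<^sup>2)"

text \<open>Derivatives are taken within \<open>S\<close>, hence one-sided at the endpoints of a closed interval;
  on a nondegenerate interval \<open>g'\<close> is uniquely determined on \<open>S\<close> by \<open>g\<close>.\<close>

definition has_C1_derivative_on :: "(real \<Rightarrow> real) \<Rightarrow> (real \<Rightarrow> real) \<Rightarrow> real set \<Rightarrow> bool" where
  "has_C1_derivative_on g g' S \<longleftrightarrow>
     (\<forall>x\<in>S. (g has_real_derivative g' x) (at x within S)) \<and> continuous_on S g'"

text \<open>Below, \<open>u'\<close> is the derivative of \<open>u\<close> and \<open>p'\<close> that of the flux \<open>r\<^sup>N\<^sup>-\<^sup>1 \<phi>\<^sub>1(u')\<close>.\<close>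

definition positive_solution ::
  "nat \<Rightarrow> real \<Rightarrow> real \<Rightarrow> real \<Rightarrow> (real \<Rightarrow> real \<Rightarrow> real) \<Rightarrow> real \<Rightarrow> (real \<Rightarrow> real) \<Rightarrow> bool" where
  "positive_solution N \<delta> R \<alpha> f lam u \<longleftrightarrow>
     (\<forall>r\<in>{\<delta>..R}. u r \<in> {0..<\<alpha>}) \<and>
     (\<forall>r\<in>{\<delta>..<R}. u r > 0) \<and>
     (\<exists>u' p'.
        has_C1_derivative_on u u' {\<delta>..R} \<and>
        (\<forall>r\<in>{\<delta>..R}. \<bar>u' r\<bar> < 1) \<and>
        has_C1_derivative_on (\<lambda>r. r ^ (N - 1) * phi1 (u' r)) p' {\<delta>..R} \<and>
        (\<forall>r\<in>{\<delta><..<R}. p' r + lam * r ^ (N - 1) * f r (u r) = 0) \<and>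
        u' \<delta> = 0 \<and> u R = 0)"

end

theory Submission
  imports Defs "HOL-Complex_Analysis.Great_Picard"
begin

text \<open>
  Integrating the equation twice turns the problem into the fixed point equation
  \<open>u(r) = a - \<integral>\<^sub>\<delta>\<^sup>r \<phi>\<^sub>1\<^sup>-\<^sup>1(t\<^sup>1\<^sup>-\<^sup>N \<integral>\<^sub>\<delta>\<^sup>t s\<^sup>N\<^sup>-\<^sup>1 \<lambda> f(s, u(s)) ds) dt\<close> with \<open>a = u(\<delta>)\<close>,
  where \<open>a\<close> is to be chosen so that \<open>u(R) = 0\<close>. This is a shooting problem.

  Two values of \<open>a\<close> lie on opposite sides. Since \<open>\<phi>\<^sub>1\<^sup>-\<^sup>1\<close> takes values in \<open>(-1, 1)\<close>, every
  solution descends with slope less than one, so starting at \<open>a = R\<close> it is still nonnegative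
  at \<open>R\<close>. If \<open>a\<close> is small, then \<open>\<lambda> f(r, s) \<ge> M s\<close> for all \<open>s \<le> a\<close> with a large \<open>M\<close>, and the
  solution falls so fast on the right half of the interval that it is no longer positive at \<open>R\<close>
  (lemma \<open>overshoot\<close>). The admissible heights \<open>a \<ge> a\<^sub>0\<close> stay away from zero, which excludes the
  zero solution.

  The source is merely continuous, so the initial value problem need not have a unique solution
  and \<open>u(R)\<close> is not a function of \<open>a\<close>. A delay restores uniqueness: replacing \<open>u(s)\<close> by
  \<open>u(s - h)\<close> under the integral gives an equation that is solved explicitly, by successive
  intervals of length \<open>h\<close>, with a solution depending continuously on \<open>a\<close>
  (lemma \<open>delayed_family_exists\<close>). Both estimates above hold for the delayed equation too, with
  the same constants for every \<open>h\<close>, so the intermediate value theorem provides a delayed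
  solution vanishing at \<open>R\<close>. All these functions are 1-Lipschitz, and Arzela-Ascoli yields a
  limit as \<open>h \<rightarrow> 0\<close> that solves the undelayed equation (lemma \<open>delayed_limit\<close>). The limit
  starts at a height bounded away from zero, hence it is positive on \<open>[\<delta>, R)\<close>
  (lemma \<open>integral_solution_pos\<close>).

  A single dominated convergence argument, lemma \<open>descent_tendsto\<close>, serves both for the
  continuity in \<open>a\<close> and for the passage to the limit.
\<close>

section \<open>The inverse of phi1\<close>

definition phi1_inv :: "real \<Rightarrow> real" where
  "phi1_inv y = y / sqrt (1 + y\<^sup>2)"

lemma sqrt_one_plus_square_pos: "0 < sqrt (1 + y\<^sup>2)" for y :: real
  by (simp add: add_pos_nonneg)

lemma abs_phi1_inv_less_1: "\<bar>phi1_inv y\<bar> < 1"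
proof -
  have "\<bar>y\<bar> < sqrt (1 + y\<^sup>2)"
    by (rule real_less_rsqrt) simp
  then show ?thesis
    using sqrt_one_plus_square_pos[of y] by (simp add: phi1_inv_def)
qed

lemma phi1_phi1_inv: "phi1 (phi1_inv y) = y"
proof -
  have pos: "0 < 1 + y\<^sup>2"
    by (simp add: add_pos_nonneg)
  have "1 - (phi1_inv y)\<^sup>2 = 1 / (1 + y\<^sup>2)"
    using pos by (simp add: phi1_inv_def power_divide field_simps)
  then have "phi1 (phi1_inv y) = phi1_inv y * sqrt (1 + y\<^sup>2)"
    by (simp add: phi1_def real_sqrt_divide)
  also have "\<dots> = y"
    using sqrt_one_plus_square_pos[of y] by (simp add: phi1_inv_def)
  finally show ?thesis .
qed

lemma phi1_minus: "phi1 (- s) = - phi1 s"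
  by (simp add: phi1_def)

lemma phi1_inv_0 [simp]: "phi1_inv 0 = 0"
  by (simp add: phi1_inv_def)

lemma phi1_inv_nonneg: "0 \<le> y \<Longrightarrow> 0 \<le> phi1_inv y"
  by (simp add: phi1_inv_def)

lemma phi1_inv_pos: "0 < y \<Longrightarrow> 0 < phi1_inv y"
  using sqrt_one_plus_square_pos[of y] by (simp add: phi1_inv_def)

lemma continuous_on_phi1_inv: "continuous_on S phi1_inv"
  unfolding phi1_inv_def
  by (intro continuous_intros) (use sqrt_one_plus_square_pos in \<open>auto simp: less_le\<close>)

text \<open>A linear lower bound near zero. It is stated for every \<open>y \<ge> z\<close>, which takes the place of
  monotonicity of \<^const>\<open>phi1_inv\<close> where a flux is only known to exceed \<open>z\<close>.\<close>

lemma phi1_inv_ge_half: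
  assumes "0 \<le> z" "z \<le> 1" "z \<le> y"
  shows "z / 2 \<le> phi1_inv y"
proof -
  have "z\<^sup>2 \<le> 1"
    using assms by (simp add: power_le_one)
  have "z\<^sup>2 \<le> y\<^sup>2"
    using assms by (simp add: power_mono)
  have "z\<^sup>2 * (1 + y\<^sup>2) \<le> (2 * y)\<^sup>2"
  proof -
    have "z\<^sup>2 * y\<^sup>2 \<le> 1 * y\<^sup>2"
      using \<open>z\<^sup>2 \<le> 1\<close> by (intro mult_right_mono) auto
    then show ?thesis
      using \<open>z\<^sup>2 \<le> y\<^sup>2\<close> zero_le_power2[of y]
      unfolding distrib_left power_mult_distrib power2_eq_square[of 2] by linarith
  qed
  then have "sqrt (z\<^sup>2 * (1 + y\<^sup>2)) \<le> sqrt ((2 * y)\<^sup>2)"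
    by (rule real_sqrt_le_mono)
  then have "z * sqrt (1 + y\<^sup>2) \<le> 2 * y"
    using assms by (simp add: real_sqrt_mult)
  then show ?thesis
    using sqrt_one_plus_square_pos[of y] by (simp add: phi1_inv_def field_simps)
qed

section \<open>The radial integral operator\<close>

locale radial_interval =
  fixes n :: nat and \<delta> R :: real
  assumes delta_nonneg: "0 \<le> \<delta>" and delta_less: "\<delta> < R"
begin

text \<open>For a source \<open>g\<close>, the solution of \<open>(r\<^sup>n \<phi>\<^sub>1(u'))' = - r\<^sup>n g\<close> with \<open>u'(\<delta>) = 0\<close> has
  \<open>r\<^sup>n \<phi>\<^sub>1(u') = - mass g\<close>, its slope is \<open>- steepness g\<close>, and \<open>descent g r = u(\<delta>) - u(r)\<close>. When \<open>\<delta> = 0\<close>, the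
  division in \<open>steepness\<close> at \<open>t = 0\<close> still gives the correct slope zero, because the mass
  vanishes there.\<close>

definition mass :: "(real \<Rightarrow> real) \<Rightarrow> real \<Rightarrow> real" where
  "mass g t = integral {\<delta>..t} (\<lambda>s. s ^ n * g s)"

definition steepness :: "(real \<Rightarrow> real) \<Rightarrow> real \<Rightarrow> real" where
  "steepness g t = phi1_inv (mass g t / t ^ n)"

definition descent :: "(real \<Rightarrow> real) \<Rightarrow> real \<Rightarrow> real" where
  "descent g r = integral {\<delta>..r} (steepness g)"

lemma density_continuous:
  "continuous_on {\<delta>..R} g \<Longrightarrow> continuous_on {\<delta>..R} (\<lambda>s. s ^ n * g s)"
  by (intro continuous_intros)

lemma density_integrable:
  "continuous_on {\<delta>..R} g \<Longrightarrow> {a..t} \<subseteq> {\<delta>..R} \<Longrightarrow> (\<lambda>s. s ^ n * g s) integrable_on {a..t}"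
  by (rule integrable_continuous_real, rule continuous_on_subset[OF density_continuous])

lemma mass_has_derivative:
  assumes "continuous_on {\<delta>..R} g" "t \<in> {\<delta>..R}"
  shows "(mass g has_real_derivative t ^ n * g t) (at t within {\<delta>..R})"
  unfolding mass_def[abs_def]
  using integral_has_real_derivative[OF density_continuous[OF assms(1)] assms(2)] .

lemma mass_delta [simp]: "mass g \<delta> = 0"
  by (simp add: mass_def)

lemma mass_nonneg:
  assumes "\<And>s. s \<in> {\<delta>..R} \<Longrightarrow> 0 \<le> g s" "t \<in> {\<delta>..R}"
  shows "0 \<le> mass g t"
  unfolding mass_def using assms delta_nonneg
  by (cases "(\<lambda>s. s ^ n * g s) integrable_on {\<delta>..t}") (auto intro!: integral_nonneg simp: not_integrable_integral)


text \<open>Bounding the weight \<open>s\<^sup>n\<close> by its value at the right end \<open>t\<close> produces the factor \<open>t\<^sup>n\<close> that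
  cancels the singular denominator in \<open>steepness\<close>.\<close>

lemma mass_le:
  assumes cont: "continuous_on {\<delta>..R} g"
    and g: "\<And>s. s \<in> {\<delta>..R} \<Longrightarrow> 0 \<le> g s \<and> g s \<le> B" and t: "t \<in> {\<delta>..R}"
  shows "mass g t \<le> (t - \<delta>) * B * t ^ n"
proof -
  have "mass g t \<le> integral {\<delta>..t} (\<lambda>s. t ^ n * B)"
    unfolding mass_def
  proof (rule integral_le)
    show "(\<lambda>s. s ^ n * g s) integrable_on {\<delta>..t}"
      using cont t by (intro density_integrable) auto
    show "s ^ n * g s \<le> t ^ n * B" if "s \<in> {\<delta>..t}" for s
      using that t g[of s] delta_nonneg by (intro mult_mono power_mono) auto
  qed auto
  also have "\<dots> = (t - \<delta>) * B * t ^ n"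
    using t by simp
  finally show ?thesis .
qed

text \<open>The quotient is singular only at \<open>t = 0\<close>, that is at \<open>t = \<delta>\<close> when \<open>\<delta> = 0\<close>. There it is
  squeezed to zero by \<open>(t - \<delta>) B\<close>, where \<open>B\<close> bounds \<open>g\<close>.\<close>

lemma flux_continuous:
  assumes cont: "continuous_on {\<delta>..R} g"
    and g: "\<And>s. s \<in> {\<delta>..R} \<Longrightarrow> 0 \<le> g s"
  shows "continuous_on {\<delta>..R} (\<lambda>t. mass g t / t ^ n)"
  unfolding continuous_on_eq_continuous_within
proof
  fix t assume t: "t \<in> {\<delta>..R}"
  have "compact (g ` {\<delta>..R})"
    using cont by (intro compact_continuous_image) auto
  then obtain B where B: "\<forall>s\<in>{\<delta>..R}. norm (g s) \<le> B"
    using compact_imp_bounded[of "g ` {\<delta>..R}"] unfolding bounded_iff by blast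
  show "continuous (at t within {\<delta>..R}) (\<lambda>t. mass g t / t ^ n)"
  proof (cases "t = \<delta>")
    case True
    have le: "norm (mass g s / s ^ n) \<le> (s - \<delta>) * B" if s: "s \<noteq> \<delta>" "s \<in> {\<delta>..R}" for s
    proof -
      have "0 < s"
        using s delta_nonneg by auto
      moreover have "mass g s \<le> (s - \<delta>) * B * s ^ n"
        using s B g by (intro mass_le[OF cont]) force+
      moreover have "0 \<le> mass g s"
        using s g by (intro mass_nonneg) auto
      ultimately show ?thesis
        by (simp add: divide_le_eq)
    qed
    have "((\<lambda>s. (s - \<delta>) * B) \<longlongrightarrow> (\<delta> - \<delta>) * B) (at \<delta> within {\<delta>..R})"
      by (intro tendsto_intros)
    then have bound_lim: "((\<lambda>s. (s - \<delta>) * B) \<longlongrightarrow> 0) (at \<delta> within {\<delta>..R})"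
      by simp
    have "\<forall>\<^sub>F s in at \<delta> within {\<delta>..R}. norm (mass g s / s ^ n) \<le> (s - \<delta>) * B"
      unfolding eventually_at_filter using le by (intro always_eventually) blast
    then have "((\<lambda>s. mass g s / s ^ n) \<longlongrightarrow> 0) (at \<delta> within {\<delta>..R})"
      using bound_lim by (rule Lim_null_comparison)
    then show ?thesis
      by (simp add: True continuous_within)
  next
    case False
    then show ?thesis
      using t delta_nonneg
      by (intro continuous_intros DERIV_continuous[OF mass_has_derivative[OF cont t]]) auto
  qed
qed

lemma steepness_continuous:
  assumes "continuous_on {\<delta>..R} g" "\<And>s. s \<in> {\<delta>..R} \<Longrightarrow> 0 \<le> g s"
  shows "continuous_on {\<delta>..R} (steepness g)"
  unfolding steepness_def[abs_def]
  by (rule continuous_on_compose2[OF continuous_on_phi1_inv flux_continuous[OF assms]]) auto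

lemma abs_steepness_less_1: "\<bar>steepness g t\<bar> < 1"
  by (simp add: steepness_def abs_phi1_inv_less_1)

lemma steepness_nonneg:
  assumes "\<And>s. s \<in> {\<delta>..R} \<Longrightarrow> 0 \<le> g s" "t \<in> {\<delta>..R}"
  shows "0 \<le> steepness g t"
  using mass_nonneg[OF assms] assms(2) delta_nonneg
  by (auto simp: steepness_def intro!: phi1_inv_nonneg divide_nonneg_nonneg)

lemma descent_delta [simp]: "descent g \<delta> = 0"
  by (simp add: descent_def)

lemma descent_has_derivative:
  assumes "continuous_on {\<delta>..R} g" "\<And>s. s \<in> {\<delta>..R} \<Longrightarrow> 0 \<le> g s" "t \<in> {\<delta>..R}"
  shows "(descent g has_real_derivative steepness g t) (at t within {\<delta>..R})"
  unfolding descent_def[abs_def]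
  using integral_has_real_derivative[OF steepness_continuous[OF assms(1,2)] assms(3)] by simp

lemma descent_increment:
  assumes cont: "continuous_on {\<delta>..R} g" and g: "\<And>s. s \<in> {\<delta>..R} \<Longrightarrow> 0 \<le> g s"
    and xy: "\<delta> \<le> x" "x \<le> y" "y \<le> R"
  shows "descent g y - descent g x = integral {x..y} (steepness g)"
    and "steepness g integrable_on {x..y}"
proof -
  have int: "steepness g integrable_on {a..b}" if "\<delta> \<le> a" "b \<le> R" for a b
    using that by (intro integrable_continuous_real
        continuous_on_subset[OF steepness_continuous[OF cont g]]) auto
  show "steepness g integrable_on {x..y}"
    using xy by (intro int)
  show "descent g y - descent g x = integral {x..y} (steepness g)"
    using Henstock_Kurzweil_Integration.integral_combine[OF xy(1,2) int] xy
    by (simp add: descent_def)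
qed

lemma descent_increment_ge:
  assumes cont: "continuous_on {\<delta>..R} g" and g: "\<And>s. s \<in> {\<delta>..R} \<Longrightarrow> 0 \<le> g s"
    and xy: "\<delta> \<le> x" "x \<le> y" "y \<le> R"
    and m: "\<And>t. t \<in> {x..y} \<Longrightarrow> m \<le> steepness g t"
  shows "(y - x) * m \<le> descent g y - descent g x"
proof -
  have "integral {x..y} (\<lambda>_. m) \<le> integral {x..y} (steepness g)"
    using descent_increment(2)[OF cont g xy] m by (intro integral_le) auto
  then show ?thesis
    using descent_increment(1)[OF cont g xy] xy by simp
qed

lemma descent_mono:
  assumes "continuous_on {\<delta>..R} g" "\<And>s. s \<in> {\<delta>..R} \<Longrightarrow> 0 \<le> g s"
    and "\<delta> \<le> x" "x \<le> y" "y \<le> R"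
  shows "descent g x \<le> descent g y"
  using descent_increment_ge[OF assms, of 0] steepness_nonneg[OF assms(2)] assms(3-) by simp

lemma descent_increment_le:
  assumes cont: "continuous_on {\<delta>..R} g" and g: "\<And>s. s \<in> {\<delta>..R} \<Longrightarrow> 0 \<le> g s"
    and xy: "\<delta> \<le> x" "x \<le> y" "y \<le> R"
  shows "descent g y - descent g x \<le> y - x"
proof -
  have "integral {x..y} (steepness g) \<le> integral {x..y} (\<lambda>_. 1)"
    using descent_increment(2)[OF cont g xy] abs_steepness_less_1[of g]
    by (intro integral_le) (auto simp: abs_less_iff less_imp_le)
  then show ?thesis
    using descent_increment(1)[OF cont g xy] xy by simp
qed

text \<open>The descent up to \<open>r\<close> only sees the source to the left of \<open>r\<close>. This causality is what makes
  the method of steps work.\<close>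

lemma descent_cong:
  assumes "\<And>s. s \<in> {\<delta>..r} \<Longrightarrow> g s = g' s"
  shows "descent g r = descent g' r"
proof -
  have "mass g t = mass g' t" if "t \<in> {\<delta>..r}" for t
    unfolding mass_def using assms that by (intro integral_cong) auto
  then show ?thesis
    unfolding descent_def by (intro integral_cong) (auto simp: steepness_def)
qed

text \<open>Dominated convergence for the inner and then the outer integral; the outer one is dominated
  by 1 because \<^const>\<open>phi1_inv\<close> is bounded.\<close>

lemma descent_tendsto:
  assumes cont: "\<And>k. continuous_on {\<delta>..R} (g k)"
    and g: "\<And>k s. s \<in> {\<delta>..R} \<Longrightarrow> 0 \<le> g k s \<and> g k s \<le> B"
    and lim: "\<And>s. s \<in> {\<delta>..R} \<Longrightarrow> (\<lambda>k. g k s) \<longlonglongrightarrow> g' s"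
    and r: "r \<in> {\<delta>..R}"
  shows "(\<lambda>k. descent (g k) r) \<longlonglongrightarrow> descent g' r"
proof -
  have mass: "(\<lambda>k. mass (g k) t) \<longlonglongrightarrow> mass g' t" if t: "t \<in> {\<delta>..R}" for t
    unfolding mass_def
  proof (rule dominated_convergence)
    show "(\<lambda>s. s ^ n * g k s) integrable_on {\<delta>..t}" for k
      using cont t by (intro density_integrable) auto
    show "norm (s ^ n * g k s) \<le> R ^ n * B" if "s \<in> {\<delta>..t}" for k s
    proof -
      have "s ^ n * g k s \<le> R ^ n * B"
        using that t g[of s k] delta_nonneg by (intro mult_mono power_mono) auto
      moreover have "0 \<le> s ^ n * g k s"
        using that t g[of s k] delta_nonneg by auto
      ultimately show ?thesis
        by simp
    qed
    show "(\<lambda>k. s ^ n * g k s) \<longlonglongrightarrow> s ^ n * g' s" if "s \<in> {\<delta>..t}" for s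
      using that t lim by (intro tendsto_intros) auto
  qed auto
  have steep: "(\<lambda>k. steepness (g k) t) \<longlonglongrightarrow> steepness g' t" if "t \<in> {\<delta>..R}" for t
  proof -
    have "isCont phi1_inv y" for y
      using continuous_on_phi1_inv[of UNIV] continuous_on_eq_continuous_at[of UNIV] by auto
    moreover have "(\<lambda>k. mass (g k) t / t ^ n) \<longlonglongrightarrow> mass g' t / t ^ n"
      using mass[OF that] unfolding divide_inverse by (intro tendsto_intros)
    ultimately show ?thesis
      unfolding steepness_def by (rule isCont_tendsto_compose)
  qed
  show ?thesis
    unfolding descent_def
  proof (rule dominated_convergence)
    show "steepness (g k) integrable_on {\<delta>..r}" for k
      using descent_increment(2)[OF cont, of k \<delta> r] g r by auto
    show "norm (steepness (g k) t) \<le> 1" for k t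
      using abs_steepness_less_1[of "g k" t] by simp
    show "(\<lambda>k. steepness (g k) t) \<longlonglongrightarrow> steepness g' t" if "t \<in> {\<delta>..r}" for t
      using that r by (intro steep) auto
  qed auto
qed

lemma mass_pos:
  assumes cont: "continuous_on {\<delta>..R} g" and g: "\<And>s. s \<in> {\<delta>..R} \<Longrightarrow> 0 \<le> g s"
    and s: "\<delta> < s" "s \<le> t" "t \<le> R" "0 < g s"
  shows "0 < mass g t"
proof -
  have "continuous_on {\<delta>..t} (\<lambda>s. s ^ n * g s)"
    using s by (intro continuous_on_subset[OF density_continuous[OF cont]]) auto
  moreover have "0 \<le> x ^ n * g x" if "x \<in> {\<delta>..t}" for x
    using that s g[of x] delta_nonneg by auto
  moreover have "s ^ n * g s \<noteq> 0"
    using s delta_nonneg by auto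
  ultimately have "mass g t \<noteq> 0"
    unfolding mass_def using s by (subst integral_eq_0_iff) force+
  then show ?thesis
    using mass_nonneg[where g = g and t = t, OF g] s by auto
qed

text \<open>A source of size 1 on \<open>[\<delta>, c]\<close> alone makes \<open>mass g t / t\<^sup>n\<close> at least this large for
  every \<open>t\<close> in \<open>[c, R]\<close>.\<close>

definition flux_gain :: "real \<Rightarrow> real" where
  "flux_gain c = mass (\<lambda>_. 1) c / R ^ n"

lemma flux_gain_pos: "\<delta> < c \<Longrightarrow> c \<le> R \<Longrightarrow> 0 < flux_gain c"
  using delta_nonneg mass_pos[of "\<lambda>_. 1" c c] by (auto simp: flux_gain_def)

text \<open>Beyond \<open>c\<close> the mass can only grow, and dividing by \<open>t\<^sup>n\<close> costs at most a division by \<open>R\<^sup>n\<close>.\<close>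

lemma flux_ge:
  assumes cont: "continuous_on {\<delta>..R} g" and g: "\<And>s. s \<in> {\<delta>..R} \<Longrightarrow> 0 \<le> g s"
    and ct: "\<delta> < c" "c \<le> t" "t \<le> R"
    and m: "0 \<le> m" "\<And>s. s \<in> {\<delta>..c} \<Longrightarrow> m \<le> g s"
  shows "m * flux_gain c \<le> mass g t / t ^ n"
proof -
  have "m * mass (\<lambda>_. 1) c = integral {\<delta>..c} (\<lambda>s. m * (s ^ n * 1))"
    unfolding mass_def by (rule integral_mult_right[symmetric])
  also have "\<dots> \<le> integral {\<delta>..c} (\<lambda>s. s ^ n * g s)"
  proof (rule integral_le)
    show "(\<lambda>s. m * (s ^ n * 1)) integrable_on {\<delta>..c}"
      by (intro integrable_continuous_real continuous_intros)
    show "(\<lambda>s. s ^ n * g s) integrable_on {\<delta>..c}"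
      using ct by (intro density_integrable[OF cont]) auto
    show "m * (s ^ n * 1) \<le> s ^ n * g s" if "s \<in> {\<delta>..c}" for s
      using mult_right_mono[OF m(2)[OF that], of "s ^ n"] that delta_nonneg
      by (simp add: mult.commute)
  qed
  also have "\<dots> \<le> mass g t"
    unfolding mass_def
    using ct g delta_nonneg by (intro integral_subset_le density_integrable[OF cont]) auto
  finally have "m * mass (\<lambda>_. 1) c / R ^ n \<le> mass g t / R ^ n"
    using delta_nonneg delta_less by (intro divide_right_mono) auto
  also have "\<dots> \<le> mass g t / t ^ n"
    using ct delta_nonneg mass_nonneg[where g = g and t = t, OF g]
    by (intro divide_left_mono power_mono mult_pos_pos) auto
  finally show ?thesis
    by (simp add: flux_gain_def)
qed

end

section \<open>Shooting with a delay\<close>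

locale radial_shooting = radial_interval +
  fixes F :: "real \<Rightarrow> real \<Rightarrow> real" and B :: real
  assumes F_continuous: "continuous_on ({\<delta>..R} \<times> UNIV) (\<lambda>(r, x). F r x)"
    and F_bounds: "\<And>r x. r \<in> {\<delta>..R} \<Longrightarrow> 0 \<le> F r x \<and> F r x \<le> B"
begin

text \<open>The argument \<open>s - h\<close> is cut off at \<open>\<delta>\<close>, which amounts to prolonging \<open>u\<close> to the left by its
  initial value \<open>a\<close>. For \<open>h = 0\<close> this is the original integral equation, so that the estimates
  below cover both cases.\<close>

definition solves_delayed :: "real \<Rightarrow> real \<Rightarrow> (real \<Rightarrow> real) \<Rightarrow> bool" where
  "solves_delayed h a u \<longleftrightarrow> continuous_on {\<delta>..R} u \<and>
     (\<forall>r\<in>{\<delta>..R}. u r = a - descent (\<lambda>s. F s (u (max \<delta> (s - h)))) r)"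

lemma source_continuous:
  assumes "continuous_on {\<delta>..R} u" "0 \<le> h"
  shows "continuous_on {\<delta>..R} (\<lambda>s. F s (u (max \<delta> (s - h))))"
proof -
  have "continuous_on {\<delta>..R} (\<lambda>s. u (max \<delta> (s - h)))"
    by (rule continuous_on_compose2[OF assms(1)])
      (use assms(2) delta_less in \<open>auto intro!: continuous_intros\<close>)
  then have "continuous_on {\<delta>..R} (\<lambda>s. (s, u (max \<delta> (s - h))))"
    by (intro continuous_intros)
  from continuous_on_compose2[OF F_continuous this] show ?thesis
    by auto
qed

lemma source_nonneg: "s \<in> {\<delta>..R} \<Longrightarrow> 0 \<le> F s x"
  using F_bounds by auto

lemma F_tendsto:
  assumes "s \<in> {\<delta>..R}" "(\<lambda>k. x k) \<longlonglongrightarrow> y"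
  shows "(\<lambda>k. F s (x k)) \<longlonglongrightarrow> F s y"
proof -
  have "continuous_on UNIV (\<lambda>x. (s, x))"
    by (intro continuous_intros)
  from continuous_on_compose2[OF F_continuous this] have "continuous_on UNIV (F s)"
    using assms(1) by (simp add: image_subset_iff)
  then show ?thesis
    by (rule continuous_on_tendsto_compose[OF _ assms(2)]) auto
qed

lemma solves_delayed_start: "solves_delayed h a u \<Longrightarrow> u \<delta> = a"
  using delta_less by (simp add: solves_delayed_def)

lemma solves_delayed_decreasing:
  assumes "solves_delayed h a u" "0 \<le> h" "\<delta> \<le> x" "x \<le> y" "y \<le> R"
  shows "u y \<le> u x" and "u x - u y \<le> y - x"
proof -
  let ?g = "\<lambda>s. F s (u (max \<delta> (s - h)))"
  have cont: "continuous_on {\<delta>..R} ?g"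
    using assms by (intro source_continuous) (auto simp: solves_delayed_def)
  have "u x - u y = descent ?g y - descent ?g x"
    using assms by (simp add: solves_delayed_def)
  then show "u y \<le> u x" "u x - u y \<le> y - x"
    using descent_mono[of ?g, OF cont source_nonneg assms(3-)]
      descent_increment_le[of ?g, OF cont source_nonneg assms(3-)] by linarith+
qed

text \<open>Picard iteration. With a delay \<open>h > 0\<close>, the \<open>k\<close>-th iterate is already exact on
  \<open>[\<delta>, \<delta> + k h]\<close>: the next iterate at \<open>r\<close> only uses values at most at \<open>r - h\<close>. After finitely
  many iterations it is therefore exact on the whole interval.\<close>

primrec step_iterate :: "real \<Rightarrow> nat \<Rightarrow> real \<Rightarrow> real \<Rightarrow> real" where
  "step_iterate h 0 a = (\<lambda>r. a)"
| "step_iterate h (Suc k) a =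
     (\<lambda>r. a - descent (\<lambda>s. F s (step_iterate h k a (max \<delta> (s - h)))) r)"

lemma step_iterate_continuous:
  assumes "0 \<le> h"
  shows "continuous_on {\<delta>..R} (step_iterate h k a)"
proof (induction k)
  case (Suc k)
  have "continuous_on {\<delta>..R} (descent (\<lambda>s. F s (step_iterate h k a (max \<delta> (s - h)))))"
    by (rule DERIV_continuous_on, rule descent_has_derivative)
      (use source_continuous[OF Suc assms] source_nonneg in auto)
  then show ?case
    by (simp add: continuous_intros)
qed simp

lemma step_iterate_stable:
  assumes "0 < h"
  shows "r \<in> {\<delta>..R} \<Longrightarrow> r \<le> \<delta> + real k * h \<Longrightarrow>
    step_iterate h (Suc k) a r = step_iterate h k a r"
proof (induction k arbitrary: r)
  case 0
  then have "r = \<delta>"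
    by simp
  then show ?case
    by simp
next
  case (Suc k)
  have "F s (step_iterate h (Suc k) a (max \<delta> (s - h)))
      = F s (step_iterate h k a (max \<delta> (s - h)))" if "s \<in> {\<delta>..r}" for s
  proof -
    have "max \<delta> (s - h) \<le> \<delta> + real k * h"
      using that Suc.prems assms by (auto simp: algebra_simps)
    moreover have "max \<delta> (s - h) \<in> {\<delta>..R}"
      using that Suc.prems assms delta_less by auto
    ultimately show ?thesis
      by (simp only: Suc.IH)
  qed
  then have "descent (\<lambda>s. F s (step_iterate h (Suc k) a (max \<delta> (s - h)))) r
      = descent (\<lambda>s. F s (step_iterate h k a (max \<delta> (s - h)))) r"
    by (rule descent_cong)
  then show ?case
    by (simp only: step_iterate.simps(2))
qed

lemma step_iterate_tendsto:
  assumes "0 \<le> h" "X \<longlonglongrightarrow> a"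
  shows "r \<in> {\<delta>..R} \<Longrightarrow> (\<lambda>j. step_iterate h k (X j) r) \<longlonglongrightarrow> step_iterate h k a r"
proof (induction k arbitrary: r)
  case 0
  then show ?case
    using assms by simp
next
  case (Suc k)
  have "(\<lambda>j. descent (\<lambda>s. F s (step_iterate h k (X j) (max \<delta> (s - h)))) r)
     \<longlonglongrightarrow> descent (\<lambda>s. F s (step_iterate h k a (max \<delta> (s - h)))) r"
  proof (rule descent_tendsto)
    show "(\<lambda>j. F s (step_iterate h k (X j) (max \<delta> (s - h))))
        \<longlonglongrightarrow> F s (step_iterate h k a (max \<delta> (s - h)))" if "s \<in> {\<delta>..R}" for s
      using that assms(1) delta_less by (intro F_tendsto Suc.IH) auto
  qed (use F_bounds source_continuous step_iterate_continuous assms(1) Suc.prems in auto)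
  then show ?case
    using assms(2) by (auto intro!: tendsto_intros)
qed

lemma delayed_family_exists:
  assumes "0 < h"
  obtains U where "\<And>a. solves_delayed h a (U a)"
    and "\<And>r. r \<in> {\<delta>..R} \<Longrightarrow> continuous_on UNIV (\<lambda>a. U a r)"
proof -
  obtain k :: nat where k: "R - \<delta> \<le> real k * h"
    using ex_less_of_nat_mult[OF assms, of "R - \<delta>"] less_imp_le by blast
  have "solves_delayed h a (step_iterate h k a)" for a
  proof -
    have "step_iterate h k a r = step_iterate h (Suc k) a r" if "r \<in> {\<delta>..R}" for r
      using that k by (intro step_iterate_stable[symmetric] assms) auto
    then show ?thesis
      using step_iterate_continuous[of h k a] assms
      by (simp add: solves_delayed_def)
  qed
  moreover have "continuous_on UNIV (\<lambda>a. step_iterate h k a r)" if "r \<in> {\<delta>..R}" for r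
    unfolding continuous_on_sequentially comp_def
    using step_iterate_tendsto[OF _ _ that] assms by auto
  ultimately show thesis
    using that by blast
qed

text \<open>Delayed solutions with bounded starting heights form a relatively compact family, since they
  are 1-Lipschitz. The Lipschitz bound also makes the delay harmless in the limit: shifting the
  argument by \<open>h\<close> changes the value by at most \<open>h\<close>.\<close>

lemma delayed_limit:
  assumes sol: "\<And>k. solves_delayed (h k) (a k) (u k)"
    and h: "\<And>k. 0 \<le> h k" "h \<longlonglongrightarrow> 0"
    and a: "\<And>k. \<bar>a k\<bar> \<le> A"
  obtains v \<sigma> where "strict_mono \<sigma>" "solves_delayed 0 (v \<delta>) v"
    "\<And>r. r \<in> {\<delta>..R} \<Longrightarrow> (\<lambda>k. u (\<sigma> k) r) \<longlonglongrightarrow> v r"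
proof -
  have lip: "\<bar>u k x - u k y\<bar> \<le> \<bar>x - y\<bar>" if "x \<in> {\<delta>..R}" "y \<in> {\<delta>..R}" for k x y
  proof (cases "x \<le> y")
    case True
    then show ?thesis
      using solves_delayed_decreasing[OF sol[of k] h(1), of x y] that by auto
  next
    case False
    then show ?thesis
      using solves_delayed_decreasing[OF sol[of k] h(1), of y x] that by auto
  qed
  have bound: "norm (u k x) \<le> A + (R - \<delta>)" if "x \<in> {\<delta>..R}" for k x
    using lip[of x \<delta> k] solves_delayed_start[OF sol, of k] a[of k] that delta_less by auto
  have equicont: "\<exists>d>0. \<forall>k y. y \<in> {\<delta>..R} \<and> norm (x - y) < d \<longrightarrow> norm (u k x - u k y) < e"
    if "x \<in> {\<delta>..R}" "0 < e" for x e
    using that lip[OF that(1)] by (intro exI[of _ e]) (auto intro: le_less_trans)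
  obtain v \<sigma> where v: "continuous_on {\<delta>..R} v" and \<sigma>: "strict_mono (\<sigma> :: nat \<Rightarrow> nat)"
    and unif: "\<And>e. 0 < e \<Longrightarrow> \<exists>N. \<forall>k x. k \<ge> N \<and> x \<in> {\<delta>..R} \<longrightarrow> norm (u (\<sigma> k) x - v x) < e"
    using Arzela_Ascoli[of "{\<delta>..R}" u "A + (R - \<delta>)", OF compact_Icc bound equicont] by blast
  have lim: "(\<lambda>k. u (\<sigma> k) r) \<longlonglongrightarrow> v r" if "r \<in> {\<delta>..R}" for r
    using unif that unfolding LIMSEQ_def dist_norm by meson
  have h\<sigma>: "(\<lambda>k. h (\<sigma> k)) \<longlonglongrightarrow> 0"
    using LIMSEQ_subseq_LIMSEQ[OF h(2) \<sigma>] by (simp add: comp_def)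
  have shifted: "(\<lambda>k. u (\<sigma> k) (max \<delta> (s - h (\<sigma> k)))) \<longlonglongrightarrow> v s" if s: "s \<in> {\<delta>..R}" for s
  proof (rule Lim_transform[OF lim[OF s]])
    have le: "\<bar>u (\<sigma> k) (max \<delta> (s - h (\<sigma> k))) - u (\<sigma> k) s\<bar> \<le> h (\<sigma> k)" for k
      using lip[of "max \<delta> (s - h (\<sigma> k))" s "\<sigma> k"] s h(1)[of "\<sigma> k"] delta_less by auto
    show "(\<lambda>k. u (\<sigma> k) (max \<delta> (s - h (\<sigma> k))) - u (\<sigma> k) s) \<longlonglongrightarrow> 0"
      by (rule Lim_null_comparison[OF _ h\<sigma>]) (use le in simp)
  qed
  have fixed_point: "v r = v \<delta> - descent (\<lambda>s. F s (v s)) r" if r: "r \<in> {\<delta>..R}" for r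
  proof -
    have "(\<lambda>k. descent (\<lambda>s. F s (u (\<sigma> k) (max \<delta> (s - h (\<sigma> k))))) r)
        \<longlonglongrightarrow> descent (\<lambda>s. F s (v s)) r"
    proof (rule descent_tendsto)
      show "continuous_on {\<delta>..R} (\<lambda>s. F s (u (\<sigma> k) (max \<delta> (s - h (\<sigma> k)))))" for k
        using sol h(1) by (intro source_continuous) (auto simp: solves_delayed_def)
    qed (use F_bounds F_tendsto shifted r in auto)
    moreover have "(\<lambda>k. u (\<sigma> k) \<delta>) \<longlonglongrightarrow> v \<delta>"
      using delta_less by (intro lim) auto
    ultimately have "(\<lambda>k. u (\<sigma> k) \<delta> - descent (\<lambda>s. F s (u (\<sigma> k) (max \<delta> (s - h (\<sigma> k))))) r)
        \<longlonglongrightarrow> v \<delta> - descent (\<lambda>s. F s (v s)) r"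
      by (intro tendsto_intros)
    moreover have "u (\<sigma> k) r = u (\<sigma> k) \<delta> - descent (\<lambda>s. F s (u (\<sigma> k) (max \<delta> (s - h (\<sigma> k))))) r"
      for k
      using sol[of "\<sigma> k"] solves_delayed_start[OF sol, of "\<sigma> k"] r
      by (simp add: solves_delayed_def)
    ultimately show ?thesis
      using lim[OF r] LIMSEQ_unique by simp
  qed
  have "v r = v \<delta> - descent (\<lambda>s. F s (v (max \<delta> (s - 0)))) r" if r: "r \<in> {\<delta>..R}" for r
  proof -
    have "descent (\<lambda>s. F s (v (max \<delta> (s - 0)))) r = descent (\<lambda>s. F s (v s)) r"
      by (rule descent_cong) (auto simp: max_def)
    then show ?thesis
      by (rule ssubst) (rule fixed_point[OF r])
  qed
  then have "solves_delayed 0 (v \<delta>) v"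
    using v unfolding solves_delayed_def by blast
  with \<sigma> show thesis
    using lim by (rule that)
qed

text \<open>The two sign conditions are required for all delayed solutions with the same \<open>a\<^sub>0\<close> and \<open>a\<^sub>1\<close>;
  this uniformity in \<open>h\<close> keeps the limiting height in \<open>[a\<^sub>0, a\<^sub>1]\<close>.\<close>

theorem shooting:
  assumes "a\<^sub>0 \<le> a\<^sub>1"
    and low: "\<And>h u. 0 < h \<Longrightarrow> solves_delayed h a\<^sub>0 u \<Longrightarrow> u R \<le> 0"
    and high: "\<And>h u. 0 < h \<Longrightarrow> solves_delayed h a\<^sub>1 u \<Longrightarrow> 0 \<le> u R"
  obtains a u where "a \<in> {a\<^sub>0..a\<^sub>1}" "solves_delayed 0 a u" "u R = 0"
proof -
  have "\<exists>a u. a \<in> {a\<^sub>0..a\<^sub>1} \<and> solves_delayed h a u \<and> u R = 0" if h: "0 < h" for h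
  proof -
    obtain U where U: "\<And>a. solves_delayed h a (U a)"
      and cont: "\<And>r. r \<in> {\<delta>..R} \<Longrightarrow> continuous_on UNIV (\<lambda>a. U a r)"
      using delayed_family_exists[OF h] by blast
    have "continuous_on {a\<^sub>0..a\<^sub>1} (\<lambda>a. U a R)"
      using delta_less by (intro continuous_on_subset[OF cont]) auto
    then obtain a where "a\<^sub>0 \<le> a" "a \<le> a\<^sub>1" "U a R = 0"
      using IVT'[of "\<lambda>a. U a R" a\<^sub>0 0 a\<^sub>1] low[OF h U] high[OF h U] assms(1) by blast
    then show ?thesis
      using U by auto
  qed
  then have "\<forall>k. \<exists>a u. a \<in> {a\<^sub>0..a\<^sub>1} \<and> solves_delayed (inverse (real (Suc k))) a u \<and> u R = 0"
    by simp
  then obtain a u where a: "\<And>k. a k \<in> {a\<^sub>0..a\<^sub>1}"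
    and u: "\<And>k. solves_delayed (inverse (real (Suc k))) (a k) (u k)" and zero: "\<And>k. u k R = 0"
    by metis
  have a_bound: "\<bar>a k\<bar> \<le> max \<bar>a\<^sub>0\<bar> \<bar>a\<^sub>1\<bar>" for k
    using a[of k] by auto
  obtain v \<sigma> where v: "solves_delayed 0 (v \<delta>) v"
    and lim: "\<And>r. r \<in> {\<delta>..R} \<Longrightarrow> (\<lambda>k. u (\<sigma> k) r) \<longlonglongrightarrow> v r"
    by (rule delayed_limit[OF u _ LIMSEQ_inverse_real_of_nat a_bound]) (auto intro: that)
  have "(\<lambda>k. a (\<sigma> k)) \<longlonglongrightarrow> v \<delta>"
    using lim[of \<delta>] delta_less solves_delayed_start[OF u] by simp
  then have "v \<delta> \<in> {a\<^sub>0..a\<^sub>1}"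
    by (rule Lim_in_closed_set[rotated 3]) (use a in auto)
  moreover have "v R = 0"
    using lim[of R] delta_less zero LIMSEQ_unique[OF tendsto_const, of 0 "v R"] by simp
  ultimately show thesis
    using that v by blast
qed

text \<open>Suppose \<open>u(c) > 0\<close>. To the left of \<open>c\<close> the solution stays above \<open>u(c)\<close>, and the delay only
  looks further to the left, so the source there is at least \<open>M u(c)\<close>. This forces
  a slope of at least \<open>M u(c) flux_gain(c) / 2\<close> on all of \<open>[c, R]\<close>, and the condition on \<open>M\<close> says
  that this suffices to descend by \<open>u(c)\<close>. Smallness of \<open>a\<close> keeps \<open>M u(c) flux_gain(c)\<close> below 1, where
  \<^const>\<open>phi1_inv\<close> is bounded below linearly.\<close>

lemma overshoot:
  assumes sol: "solves_delayed h a u" and h: "0 \<le> h"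
    and c: "\<delta> < c" "c \<le> R" and "0 \<le> M"
    and steep: "\<And>r x. r \<in> {\<delta>..R} \<Longrightarrow> x \<in> {0..a} \<Longrightarrow> M * x \<le> F r x"
    and gain: "2 \<le> M * flux_gain c * (R - c)" and small: "a * (M * flux_gain c) \<le> 1"
  shows "u R \<le> 0"
proof (cases "u c \<le> 0")
  case True
  then show ?thesis
    using solves_delayed_decreasing(1)[OF sol h, of c R] c by simp
next
  case False
  let ?g = "\<lambda>s. F s (u (max \<delta> (s - h)))"
  let ?z = "(M * u c) * flux_gain c"
  have cont: "continuous_on {\<delta>..R} ?g"
    using sol h by (intro source_continuous) (auto simp: solves_delayed_def)
  have above: "M * u c \<le> ?g s" if s: "s \<in> {\<delta>..c}" for s
  proof -
    have "u c \<le> u (max \<delta> (s - h))" "u (max \<delta> (s - h)) \<le> u \<delta>"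
      using s c h by (auto intro!: solves_delayed_decreasing(1)[OF sol h])
    then have "u (max \<delta> (s - h)) \<in> {0..a}"
      using False solves_delayed_start[OF sol] by auto
    then have "M * u (max \<delta> (s - h)) \<le> ?g s"
      using s c by (intro steep) auto
    moreover have "M * u c \<le> M * u (max \<delta> (s - h))"
      using \<open>u c \<le> u (max \<delta> (s - h))\<close> \<open>0 \<le> M\<close> by (rule mult_left_mono)
    ultimately show ?thesis
      by simp
  qed
  have gain_pos: "0 < flux_gain c"
    using c by (rule flux_gain_pos)
  have "u c \<le> a"
    using solves_delayed_decreasing(1)[OF sol h, of \<delta> c] solves_delayed_start[OF sol] c by simp
  then have "u c * (M * flux_gain c) \<le> a * (M * flux_gain c)"
    using \<open>0 \<le> M\<close> gain_pos by (intro mult_right_mono) auto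
  then have z: "0 \<le> ?z" "?z \<le> 1"
    using small False \<open>0 \<le> M\<close> gain_pos by (auto simp: mult_ac)
  have "?z / 2 \<le> steepness ?g t" if t: "t \<in> {c..R}" for t
    unfolding steepness_def
  proof (rule phi1_inv_ge_half[OF z])
    show "?z \<le> mass ?g t / t ^ n"
      using t c False \<open>0 \<le> M\<close>
      by (intro flux_ge[of ?g, OF cont source_nonneg _ _ _ _ above]) auto
  qed
  then have "(R - c) * (?z / 2) \<le> descent ?g R - descent ?g c"
    using c by (intro descent_increment_ge[of ?g, OF cont source_nonneg]) auto
  also have "\<dots> = u c - u R"
    using sol c by (simp add: solves_delayed_def)
  finally have "(R - c) * (?z / 2) \<le> u c - u R" .
  moreover have "u c * 2 \<le> u c * (M * flux_gain c * (R - c))"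
    using gain False by (intro mult_left_mono) auto
  moreover have "(R - c) * (?z / 2) = u c * (M * flux_gain c * (R - c)) / 2"
    by simp
  ultimately show ?thesis
    by linarith
qed

text \<open>A zero before \<open>R\<close> would make \<open>u\<close> constant from there on, because \<open>u\<close> decreases to zero at
  \<open>R\<close>. But the source is positive near \<open>\<delta>\<close>, where \<open>u\<close> is still close to \<open>a\<close>, so the mass and
  with it the steepness is positive at \<open>R\<close>.\<close>

lemma integral_solution_pos:
  assumes sol: "solves_delayed 0 a u" and "0 < a" and zero: "u R = 0"
    and F_pos: "\<And>r x. r \<in> {\<delta>..R} \<Longrightarrow> x \<in> {0<..a} \<Longrightarrow> 0 < F r x"
    and r: "r \<in> {\<delta>..<R}"
  shows "0 < u r"
proof (rule ccontr)
  let ?g = "\<lambda>s. F s (u (max \<delta> (s - 0)))"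
  assume "\<not> 0 < u r"
  moreover have "0 \<le> u r"
    using solves_delayed_decreasing(1)[OF sol, of r R] zero r by auto
  ultimately have "u r = 0"
    by simp
  have cont: "continuous_on {\<delta>..R} ?g"
    using sol by (intro source_continuous) (auto simp: solves_delayed_def)
  have "integral {r..R} (steepness ?g) = descent ?g R - descent ?g r"
    using r by (intro descent_increment(1)[of ?g, OF cont source_nonneg, symmetric]) auto
  also have "\<dots> = u r - u R"
    using sol r by (simp add: solves_delayed_def)
  finally have "integral {r..R} (steepness ?g) = 0"
    using \<open>u r = 0\<close> zero by simp
  moreover have "continuous_on {r..R} (steepness ?g)"
    using r by (intro continuous_on_subset[OF steepness_continuous[of ?g, OF cont source_nonneg]]) auto
  moreover have "0 \<le> steepness ?g x" if "x \<in> {r..R}" for x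
    using that r by (intro steepness_nonneg source_nonneg) auto
  ultimately have "steepness ?g R = 0"
    using r by (subst (asm) integral_eq_0_iff) auto
  moreover have "0 < steepness ?g R"
  proof -
    \<comment> \<open>a point so close to \<open>\<delta>\<close> that, with slope at most 1, \<open>u\<close> has lost at most half its height\<close>
    define s where "s = \<delta> + min (R - \<delta>) (a / 2)"
    have s: "\<delta> < s" "s \<le> R" "s - \<delta> \<le> a / 2"
      using delta_less \<open>0 < a\<close> by (simp_all add: s_def min_def)
    have "u s \<in> {0<..a}"
      using solves_delayed_decreasing[OF sol, of \<delta> s] s solves_delayed_start[OF sol] \<open>0 < a\<close>
      by auto
    then have "0 < F s (u s)"
      using s by (intro F_pos) auto
    then have "0 < mass ?g R"
      using s by (intro mass_pos[of ?g, OF cont source_nonneg, of s]) (auto simp: max_def)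
    then show ?thesis
      using delta_nonneg delta_less unfolding steepness_def
      by (intro phi1_inv_pos divide_pos_pos) auto
  qed
  ultimately show False
    by simp
qed

text \<open>Undoing the two integrations: the derivative of \<open>u\<close> is minus the steepness, and applying
  \<^const>\<open>phi1\<close> and multiplying by \<open>r\<^sup>n\<close> recovers minus the mass, whose derivative is the weighted
  source.\<close>

lemma integral_solution_regular:
  assumes sol: "solves_delayed 0 a u"
  obtains u' p' where "has_C1_derivative_on u u' {\<delta>..R}" "\<And>r. \<bar>u' r\<bar> < 1"
    "has_C1_derivative_on (\<lambda>r. r ^ n * phi1 (u' r)) p' {\<delta>..R}"
    "\<And>r. p' r = - (r ^ n * F r (u r))" "u' \<delta> = 0"
proof -
  define g where "g s = F s (u s)" for s
  have u: "u r = a - descent g r" if "r \<in> {\<delta>..R}" for r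
  proof -
    have "descent (\<lambda>s. F s (u (max \<delta> (s - 0)))) r = descent g r"
      by (rule descent_cong) (auto simp: g_def max_def)
    then show ?thesis
      using sol that by (simp add: solves_delayed_def)
  qed
  have "continuous_on {\<delta>..R} (\<lambda>s. F s (u (max \<delta> (s - 0))))"
    using sol by (intro source_continuous) (auto simp: solves_delayed_def)
  then have cont: "continuous_on {\<delta>..R} g"
    by (rule continuous_on_eq) (auto simp: g_def max_def)
  have g: "0 \<le> g s" if "s \<in> {\<delta>..R}" for s
    using that by (simp add: g_def source_nonneg)
  let ?u' = "\<lambda>r. - steepness g r"
  have "(u has_real_derivative ?u' r) (at r within {\<delta>..R})" if r: "r \<in> {\<delta>..R}" for r
  proof -
    have "((\<lambda>r. a - descent g r) has_real_derivative ?u' r) (at r within {\<delta>..R})"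
      using descent_has_derivative[OF cont g r] by (auto intro!: derivative_eq_intros)
    then show ?thesis
      by (rule has_field_derivative_transform_within[OF _ zero_less_one r]) (simp add: u)
  qed
  then have "has_C1_derivative_on u ?u' {\<delta>..R}"
    using steepness_continuous[OF cont g]
    by (auto simp: has_C1_derivative_on_def intro!: continuous_intros)
  moreover have "has_C1_derivative_on (\<lambda>r. r ^ n * phi1 (?u' r)) (\<lambda>r. - (r ^ n * g r)) {\<delta>..R}"
  proof -
    have flux: "r ^ n * phi1 (?u' r) = - mass g r" if "r \<in> {\<delta>..R}" for r
    proof (cases "r = 0")
      case True
      then have "r = \<delta>"
        using that delta_nonneg by simp
      then show ?thesis
        by (simp add: steepness_def phi1_def)
    qed (simp add: steepness_def phi1_minus phi1_phi1_inv)
    have "((\<lambda>r. r ^ n * phi1 (?u' r)) has_real_derivative - (r ^ n * g r)) (at r within {\<delta>..R})"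
      if r: "r \<in> {\<delta>..R}" for r
      by (rule has_field_derivative_transform_within[OF
            DERIV_minus[OF mass_has_derivative[OF cont r]] zero_less_one r]) (simp add: flux)
    then show ?thesis
      using cont by (auto simp: has_C1_derivative_on_def intro!: continuous_intros)
  qed
  moreover have "\<bar>?u' r\<bar> < 1" for r
    using abs_steepness_less_1 by simp
  moreover have "?u' \<delta> = 0"
    by (simp add: steepness_def)
  ultimately show thesis
    using that by (simp add: g_def)
qed

end

section \<open>Existence of a positive solution\<close>

theorem corollary1p2:
  fixes N :: nat and R \<delta> \<alpha> :: real and f :: "real \<Rightarrow> real \<Rightarrow> real"
  assumes "N \<ge> 2"
    and "0 < R"
    and "0 \<le> \<delta>" and "\<delta> < R"
    and "R < \<alpha>"
    and "continuous_on ({\<delta>..R} \<times> {0..<\<alpha>}) (\<lambda>(r, s). f r s)"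
    and "\<And>r s. r \<in> {\<delta>..R} \<Longrightarrow> s \<in> {0..<\<alpha>} \<Longrightarrow> f r s \<ge> 0"
    and "\<And>r s. r \<in> {\<delta>..R} \<Longrightarrow> s \<in> {0<..<\<alpha>} \<Longrightarrow> f r s > 0"
    and "\<And>M::real. \<forall>\<^sub>F s in at_right 0. \<forall>r\<in>{\<delta>..R}. f r s / s > M"
    and "\<And>r. r \<in> {\<delta>..R} \<Longrightarrow> f r 0 = 0"
  shows "\<forall>lam>0. \<exists>u. positive_solution N \<delta> R \<alpha> f lam u"
proof (intro allI impI)
  fix lam :: real assume "0 < lam"
  \<comment> \<open>Clipping to \<open>[0, R]\<close> makes the source total and bounded. The solution
    found will take values in this range, so that the clipping leaves its source unchanged.\<close>
  define clip where "clip x = max 0 (min R x)" for x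
  define F where "F r x = lam * f r (clip x)" for r x
  have clip_range: "clip x \<in> {0..R}" for x
    using assms(2) by (auto simp: clip_def)
  have clip_id: "clip x = x" if "x \<in> {0..R}" for x
    using that by (auto simp: clip_def)
  have F_continuous: "continuous_on ({\<delta>..R} \<times> UNIV) (\<lambda>(r, x). F r x)"
  proof -
    have "continuous_on ({\<delta>..R} \<times> UNIV) (\<lambda>p. (fst p, clip (snd p)))"
      unfolding clip_def by (intro continuous_intros)
    moreover have "(\<lambda>p. (fst p, clip (snd p))) ` ({\<delta>..R} \<times> UNIV) \<subseteq> {\<delta>..R} \<times> {0..<\<alpha>}"
      using clip_range assms(5) by (fastforce simp: image_subset_iff)
    ultimately have "continuous_on ({\<delta>..R} \<times> UNIV) (\<lambda>p. f (fst p) (clip (snd p)))"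
      using continuous_on_compose2[OF assms(6)] by fastforce
    then show ?thesis
      unfolding F_def case_prod_beta by (intro continuous_intros)
  qed
  obtain B where B: "\<And>r x. r \<in> {\<delta>..R} \<Longrightarrow> F r x \<le> B"
  proof -
    have "compact ((\<lambda>(r, x). F r x) ` ({\<delta>..R} \<times> {0..R}))"
      by (rule compact_continuous_image[OF continuous_on_subset[OF F_continuous]])
        (auto intro!: compact_Times)
    then obtain B where B: "\<forall>y\<in>(\<lambda>(r, x). F r x) ` ({\<delta>..R} \<times> {0..R}). norm y \<le> B"
      using compact_imp_bounded[of "(\<lambda>(r, x). F r x) ` ({\<delta>..R} \<times> {0..R})"]
      unfolding bounded_iff by meson
    have "F r (clip x) \<le> B" if "r \<in> {\<delta>..R}" for r x
    proof -
      have "F r (clip x) \<in> (\<lambda>(r, x). F r x) ` ({\<delta>..R} \<times> {0..R})"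
        using that clip_range[of x] by (intro image_eqI[of _ _ "(r, clip x)"]) auto
      from bspec[OF B this] show ?thesis
        by simp
    qed
    moreover have "F r (clip x) = F r x" for r x
      using clip_range by (simp add: F_def clip_id)
    ultimately show thesis
      by (intro that) simp
  qed
  have F_nonneg: "0 \<le> F r x" if "r \<in> {\<delta>..R}" for r x
    using assms(7)[OF that, of "clip x"] clip_range[of x] assms(5) \<open>0 < lam\<close> by (simp add: F_def)
  interpret radial_shooting "N - 1" \<delta> R F B
    using assms(3,4) F_continuous F_nonneg B by unfold_locales auto

  \<comment> \<open>Any point strictly between \<open>\<delta>\<close> and \<open>R\<close> would do. Then \<open>M\<close> is fixed by the
    requirement of \<open>overshoot\<close>, and the starting height \<open>a\<^sub>0\<close> last: below \<open>b\<close> for superlinearity, at most \<open>R\<close> for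
    the clipping, and at most \<open>(R - c)/2 = 1/(M flux_gain(c))\<close> for \<open>overshoot\<close>.\<close>
  define c where "c = (\<delta> + R) / 2"
  have c: "\<delta> < c" "c < R"
    using assms(4) by (auto simp: c_def)
  have gain_pos: "0 < flux_gain c"
    using c by (intro flux_gain_pos) auto
  define M where "M = 2 / (flux_gain c * (R - c))"
  have "0 < M"
    using gain_pos c by (simp add: M_def)
  have gain: "M * flux_gain c * (R - c) = 2"
  proof -
    have "flux_gain c * (R - c) \<noteq> 0"
      using gain_pos c by simp
    then show ?thesis
      unfolding M_def mult.assoc
      by (simp only: times_divide_eq_left nonzero_mult_div_cancel_right not_False_eq_True)
  qed
  obtain b where "0 < b" and b: "\<And>s r. 0 < s \<Longrightarrow> s < b \<Longrightarrow> r \<in> {\<delta>..R} \<Longrightarrow> M / lam < f r s / s"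
    using assms(9)[of "M / lam"] unfolding eventually_at_right_field by auto
  define a\<^sub>0 where "a\<^sub>0 = min (b / 2) (min R ((R - c) / 2))"
  have a\<^sub>0: "0 < a\<^sub>0" "a\<^sub>0 < b" "a\<^sub>0 \<le> R" "a\<^sub>0 \<le> (R - c) / 2"
    using \<open>0 < b\<close> assms(2) c by (simp_all add: a\<^sub>0_def min_def)
  have steep: "M * x \<le> F r x" if "r \<in> {\<delta>..R}" "x \<in> {0..a\<^sub>0}" for r x
  proof (cases "x = 0")
    case True
    then show ?thesis
      using F_nonneg[OF that(1)] by simp
  next
    case False
    then have "M / lam < f r x / x"
      using that a\<^sub>0 by (intro b) auto
    then have "M * x < lam * f r x"
      using False that \<open>0 < lam\<close> by (simp add: field_simps)
    then show ?thesis
      using that a\<^sub>0 by (simp add: F_def clip_id)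
  qed
  have "a\<^sub>0 * (M * flux_gain c) \<le> (R - c) / 2 * (M * flux_gain c)"
    using a\<^sub>0 \<open>0 < M\<close> gain_pos by (intro mult_right_mono) auto
  then have small: "a\<^sub>0 * (M * flux_gain c) \<le> 1"
    using gain by (simp add: mult_ac)
  obtain a u where a: "a \<in> {a\<^sub>0..R}" and sol: "solves_delayed 0 a u" and zero: "u R = 0"
  proof (rule shooting[of a\<^sub>0 R])
    show "u R \<le> 0" if "0 < h" "solves_delayed h a\<^sub>0 u" for h u
      using that c \<open>0 < M\<close> steep gain small by (intro overshoot[of h a\<^sub>0 u c M]) auto
    show "0 \<le> u R" if "0 < h" "solves_delayed h R u" for h u
      using solves_delayed_decreasing(2)[OF that(2), of \<delta> R] solves_delayed_start[OF that(2)]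
        that(1) assms(3,4) by simp
  qed (use a\<^sub>0 in auto)
  have range: "u r \<in> {0..R}" if "r \<in> {\<delta>..R}" for r
    using solves_delayed_decreasing(1)[OF sol, of \<delta> r] solves_delayed_decreasing(1)[OF sol, of r R]
      solves_delayed_start[OF sol] zero a that by auto
  have pos: "0 < u r" if "r \<in> {\<delta>..<R}" for r
  proof (rule integral_solution_pos[OF sol _ zero _ that])
    show "0 < F r x" if "r \<in> {\<delta>..R}" "x \<in> {0<..a}" for r x
      using assms(8)[OF that(1), of x] that a assms(5) \<open>0 < lam\<close> by (simp add: F_def clip_id)
  qed (use a a\<^sub>0 in auto)
  obtain u' p' where "has_C1_derivative_on u u' {\<delta>..R}" "\<And>r. \<bar>u' r\<bar> < 1"
    "has_C1_derivative_on (\<lambda>r. r ^ (N - 1) * phi1 (u' r)) p' {\<delta>..R}"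
    and p': "\<And>r. p' r = - (r ^ (N - 1) * F r (u r))" and "u' \<delta> = 0"
    using integral_solution_regular[OF sol] by blast
  moreover have "p' r + lam * r ^ (N - 1) * f r (u r) = 0" if "r \<in> {\<delta><..<R}" for r
    using that range[of r] p' by (simp add: F_def clip_id)
  moreover have "u r \<in> {0..<\<alpha>}" if "r \<in> {\<delta>..R}" for r
    using range[OF that] assms(5) by auto
  ultimately have "positive_solution N \<delta> R \<alpha> f lam u"
    unfolding positive_solution_def using pos zero by blast
  then show "\<exists>u. positive_solution N \<delta> R \<alpha> f lam u"
    by blast
qed

end
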